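(* The map $$\prod_{i=1}^\infty\mathbb N\to[0,1),\qquad (k_i)_{i=1}^\infty\mapsto[0,1,k_1,1,k_2,1,\dots]$$ is (well defined and) bijective, and under it finitely nonzero sequences correspond to rational numbers while infinitely nonzero sequences correspond to irrational numbers.
   Context: $\mathbb N=\{0,1,2,\dots\}$. For integers $a_0,a_1,\dots$ with $a_i\ge0$ for $i>0$, finite continued fractions are defined recursively in $\widetilde{\mathbb R}=\mathbb R\cup\{\infty\}$ (one-point compactification) by $[a_n]=a_n$ and $[a_i,a_{i+1},\dots,a_n]=a_i+1/[a_{i+1},\dots,a_n]$, with the conventions $1/0=\infty$, $1/\infty=0$, $a+\infty=\infty$ for $a\in\mathbb R$. The infinite continued fraction $[a_0,a_1,a_2,\dots]$ is $\lim_{n\to\infty}[a_0,a_1,\dots,a_n]$ when the limit exists in $\widetilde{\mathbb R}$. *)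

theory Defs
  imports "HOL-Analysis.Analysis"
begin

text \<open>
  The one-point compactification of the real line is the type \<^typ>\<open>real option\<close> with the topology
  \<^term>\<open>Alexandroff_compactification euclideanreal\<close>; \<^const>\<open>None\<close> is the point at infinity.
\<close>

definition recip_inf :: "real option \<Rightarrow> real option"
  where "recip_inf x =
    (case x of None \<Rightarrow> Some 0 | Some r \<Rightarrow> if r = 0 then None else Some (1 / r))"

definition add_inf :: "real \<Rightarrow> real option \<Rightarrow> real option"
  where "add_inf a x = map_option (\<lambda>r. a + r) x"

text \<open>Only nonempty lists are meaningful; the value at the empty list is a dummy.\<close>

fun fin_cfrac :: "int list \<Rightarrow> real option"
  where
    "fin_cfrac [] = None"
  | "fin_cfrac [a] = Some (of_int a)"
  | "fin_cfrac (a # b # as) = add_inf (of_int a) (recip_inf (fin_cfrac (b # as)))"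

definition has_cfrac_value :: "(nat \<Rightarrow> int) \<Rightarrow> real option \<Rightarrow> bool"
  where "has_cfrac_value a l \<longleftrightarrow>
    limitin (Alexandroff_compactification euclideanreal)
      (\<lambda>n. fin_cfrac (map a [0..<Suc n])) l sequentially"

definition inf_cfrac :: "(nat \<Rightarrow> int) \<Rightarrow> real option"
  where "inf_cfrac a = (THE l. has_cfrac_value a l)"

text \<open>
  The sequence \<open>0, 1, k\<^sub>1, 1, k\<^sub>2, 1, \<dots>\<close>. Sequences indexed from 1 are represented by functions
  on \<^typ>\<open>nat\<close> shifted by one: \<open>k\<^sub>i\<close> is \<open>k (i - 1)\<close>. Hence the entry \<open>k\<^sub>i\<close>, which sits at the
  even position \<open>2 i\<close>, is \<open>k (2 i div 2 - 1)\<close>.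
\<close>

definition interleave_ones :: "(nat \<Rightarrow> nat) \<Rightarrow> nat \<Rightarrow> int"
  where "interleave_ones k n =
    (if n = 0 then 0 else if odd n then 1 else int (k (n div 2 - 1)))"

end

theory Submission
  imports Defs
begin

text \<open>
  Put \<open>F k x = (k + x) / (k + x + 1) = [0, 1, k + x]\<close>. The value \<open>v\<close> of the continued fraction
  satisfies \<open>v k = F (k 0) (v k')\<close>, where \<open>k'\<close> is the shifted sequence, and its convergents are
  \<open>F (k 0) (F (k 1) (\<dots> (F (k (n - 1)) x)))\<close> with \<open>x\<close> equal to 0 or 1. The map \<open>F k\<close> sends an
  interval of length \<open>d\<close> in the unit interval to one of length at most \<open>d / (1 + d)\<close>, so \<open>n\<close> such
  maps leave a length of at most \<open>1 / (n + 1)\<close>; this gives convergence. Since \<open>F k x = y\<close> means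
  \<open>k + x = y / (1 - y)\<close>, the digits of \<open>y\<close> are recovered by taking integer and fractional parts of
  \<open>y / (1 - y)\<close>. On a rational number \<open>p / q\<close> one such step replaces the denominator \<open>q\<close> by
  \<open>q - p\<close>, so the process reaches 0.
\<close>

section \<open>Compositions of the maps \<open>step k\<close> and their contraction\<close>

definition step :: "nat \<Rightarrow> real \<Rightarrow> real"
  where "step k x = (real k + x) / (real k + x + 1)"

definition shift :: "(nat \<Rightarrow> 'a) \<Rightarrow> nat \<Rightarrow> 'a"
  where "shift k = (\<lambda>i. k (Suc i))"

fun steps :: "(nat \<Rightarrow> nat) \<Rightarrow> nat \<Rightarrow> real \<Rightarrow> real"
  where
    "steps k 0 x = x"
  | "steps k (Suc n) x = step (k 0) (steps (shift k) n x)"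

text \<open>The index \<open>n\<close> is that of the last entry kept, so the base cases are [0] and
  [0, 1], and each \<open>step\<close> accounts for two entries.\<close>

fun convergent_value :: "(nat \<Rightarrow> nat) \<Rightarrow> nat \<Rightarrow> real"
  where
    "convergent_value k 0 = 0"
  | "convergent_value k (Suc 0) = 1"
  | "convergent_value k (Suc (Suc n)) = step (k 0) (convergent_value (shift k) n)"

lemma step_bounds:
  assumes "0 \<le> x"
  shows "0 \<le> step k x" "step k x < 1"
  using assms by (auto simp: step_def)

lemma step_div:
  assumes "0 \<le> x"
  shows "step k x / (1 - step k x) = real k + x"
proof -
  have "1 - step k x = 1 / (real k + x + 1)"
    using assms by (simp add: step_def field_simps)
  then show ?thesis
    using assms by (simp add: step_def)
qed

text \<open>The difference of the images is \<open>x - y\<close> over a product that is at least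
  \<open>(1 + x) * (1 + y)\<close>. No constant factor below 1 would do, since \<open>step 0\<close>
  has slope 1 at 0.\<close>

lemma step_dist_le:
  assumes x: "0 \<le> x" and y: "0 \<le> y"
  shows "\<bar>step k x - step k y\<bar> \<le> \<bar>x - y\<bar> / (1 + \<bar>x - y\<bar>)"
proof -
  let ?D = "(real k + x + 1) * (real k + y + 1)"
  have pos: "0 < real k + x + 1" "0 < real k + y + 1"
    using x y by auto
  have "step k x - step k y = (x - y) / ?D"
    using pos by (simp add: step_def diff_frac_eq) (simp add: algebra_simps)
  then have "\<bar>step k x - step k y\<bar> = \<bar>x - y\<bar> / ?D"
    using pos by (simp add: abs_mult)
  moreover have "1 + \<bar>x - y\<bar> \<le> ?D"
  proof -
    have "(1 + x) * (1 + y) \<le> ?D"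
      using x y by (intro mult_mono) auto
    moreover have "1 + \<bar>x - y\<bar> \<le> (1 + x) * (1 + y)"
      using x y mult_nonneg_nonneg[OF x y] by (simp only: distrib_left distrib_right)
    ultimately show ?thesis by linarith
  qed
  ultimately show ?thesis
    by (simp add: frac_le)
qed

lemma steps_nonneg: "0 \<le> x \<Longrightarrow> 0 \<le> steps k n x"
  by (induction n arbitrary: k) (auto simp: step_bounds)

text \<open>The map \<open>e / (1 + e)\<close> is increasing and sends \<open>1 / (n + 1)\<close> to
  \<open>1 / (n + 2)\<close>.\<close>

lemma steps_dist_le:
  assumes "x \<in> {0..1}" "y \<in> {0..1}"
  shows "\<bar>steps k n x - steps k n y\<bar> \<le> 1 / (real n + 1)"
proof (induction n arbitrary: k)
  case 0
  then show ?case using assms by auto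
next
  case (Suc n)
  let ?d = "\<bar>steps (shift k) n x - steps (shift k) n y\<bar>"
  have d: "?d \<le> 1 / (real n + 1)" by (rule Suc.IH)
  have "\<bar>steps k (Suc n) x - steps k (Suc n) y\<bar> \<le> ?d / (1 + ?d)"
    using assms by (simp add: step_dist_le steps_nonneg)
  also have "\<dots> \<le> 1 / (real (Suc n) + 1)"
  proof -
    have "e / (1 + e) \<le> 1 / (real (Suc n) + 1)" if "0 \<le> e" "e \<le> 1 / (real n + 1)" for e
    proof -
      have "e * (real n + 1) \<le> 1"
        using that(2) by (simp add: pos_le_divide_eq)
      then have "e * (real (Suc n) + 1) \<le> 1 * (1 + e)"
        by (simp add: distrib_left)
      then show ?thesis
        using that(1) by (simp add: pos_divide_le_eq pos_le_divide_eq)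
    qed
    from this[OF abs_ge_zero d] show ?thesis .
  qed
  finally show ?case .
qed

section \<open>Convergence of the convergents\<close>

lemma convergent_value_bounds: "convergent_value k n \<in> {0..1}"
proof (induction k n rule: convergent_value.induct)
  case (3 k n)
  then show ?case
    using step_bounds[of "convergent_value (shift k) n" "k 0"] by auto
qed auto

lemma convergent_value_eq_steps:
  "convergent_value k (2 * n + m) = steps k n (convergent_value ((shift ^^ n) k) m)"
  by (induction n arbitrary: k) (auto simp: funpow_Suc_right simp del: funpow.simps)

text \<open>All convergents of index at least \<open>2 * N\<close> are images of points of the unit
  interval under the same composition of \<open>N\<close> steps.\<close>

lemma convergent_convergent_value: "convergent (convergent_value k)"
proof -
  have "Cauchy (convergent_value k)"
  proof (rule metric_CauchyI)
    fix e :: real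
    assume "0 < e"
    then obtain N where N: "1 / (real N + 1) < e"
      by (rule nat_approx_posE) (simp add: add.commute)
    have "dist (convergent_value k m) (convergent_value k n) < e" if mn: "2 * N \<le> m" "2 * N \<le> n" for m n
    proof -
      from mn obtain i j where ij: "m = 2 * N + i" "n = 2 * N + j"
        by (elim le_Suc_ex[THEN exE])
      show ?thesis
        unfolding ij convergent_value_eq_steps dist_real_def
        using steps_dist_le[OF convergent_value_bounds convergent_value_bounds] N
        by (rule order.strict_trans1)
    qed
    then show "\<exists>M. \<forall>m\<ge>M. \<forall>n\<ge>M. dist (convergent_value k m) (convergent_value k n) < e"
      by (intro exI[of _ "2 * N"]) simp
  qed
  then show ?thesis by (rule Cauchy_convergent)
qed

section \<open>The limit, its recursion and injectivity\<close>

definition cfrac_val :: "(nat \<Rightarrow> nat) \<Rightarrow> real"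
  where "cfrac_val k = lim (convergent_value k)"

lemma convergent_value_tendsto: "convergent_value k \<longlonglongrightarrow> cfrac_val k"
  unfolding cfrac_val_def convergent_LIMSEQ_iff[symmetric] by (rule convergent_convergent_value)

lemma cfrac_val_nonneg: "0 \<le> cfrac_val k"
  by (rule LIMSEQ_le_const[OF convergent_value_tendsto]) (use convergent_value_bounds in auto)

lemma cfrac_val_rec: "cfrac_val k = step (k 0) (cfrac_val (shift k))"
proof (rule LIMSEQ_unique)
  show "(\<lambda>n. convergent_value k (Suc (Suc n))) \<longlonglongrightarrow> cfrac_val k"
    by (intro LIMSEQ_Suc convergent_value_tendsto)
  show "(\<lambda>n. convergent_value k (Suc (Suc n))) \<longlonglongrightarrow> step (k 0) (cfrac_val (shift k))"
    using cfrac_val_nonneg[of "shift k"]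
    by (auto simp: step_def intro!: tendsto_intros convergent_value_tendsto)
qed

text \<open>Limits of the convergents could still be 1; the strict bound comes from one application
  of \<open>step\<close>.\<close>

lemma cfrac_val_bounds: "cfrac_val k \<in> {0..<1}"
  using step_bounds[OF cfrac_val_nonneg[of "shift k"], of "k 0"] cfrac_val_rec[of k] by simp

lemma cfrac_val_div: "cfrac_val k / (1 - cfrac_val k) = real (k 0) + cfrac_val (shift k)"
  by (subst (1 2) cfrac_val_rec) (rule step_div[OF cfrac_val_nonneg])

text \<open>The digit and the tail value are the integer and fractional parts of the same real
  number.\<close>

lemma cfrac_val_eqD:
  assumes "cfrac_val k = cfrac_val l"
  shows "k 0 = l 0" "cfrac_val (shift k) = cfrac_val (shift l)"
proof -
  have eq: "real (k 0) + cfrac_val (shift k) = real (l 0) + cfrac_val (shift l)"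
    using assms cfrac_val_div by metis
  then show "k 0 = l 0"
    using cfrac_val_bounds[of "shift k"] cfrac_val_bounds[of "shift l"] by auto
  with eq show "cfrac_val (shift k) = cfrac_val (shift l)" by simp
qed

lemma inj_cfrac_val: "inj cfrac_val"
proof (rule injI, rule ext)
  fix k l :: "nat \<Rightarrow> nat" and n
  assume "cfrac_val k = cfrac_val l"
  then show "k n = l n"
  proof (induction n arbitrary: k l)
    case 0
    then show ?case by (rule cfrac_val_eqD)
  next
    case (Suc n)
    then show ?case using cfrac_val_eqD(2) unfolding shift_def by metis
  qed
qed

section \<open>Digit expansion and surjectivity\<close>

lemma cfrac_val_eq_steps: "cfrac_val k = steps k n (cfrac_val ((shift ^^ n) k))"
proof (induction n arbitrary: k)
  case (Suc n)
  show ?case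
    using cfrac_val_rec[of k] Suc[of "shift k"] by (simp add: funpow_swap1)
qed simp

text \<open>An analogue of the Gauss map: it sends \<open>cfrac_val k\<close> to
  \<open>cfrac_val (shift k)\<close>.\<close>

definition tail_map :: "real \<Rightarrow> real"
  where "tail_map x = frac (x / (1 - x))"

definition digits :: "real \<Rightarrow> nat \<Rightarrow> nat"
  where "digits x n = nat \<lfloor>(tail_map ^^ n) x / (1 - (tail_map ^^ n) x)\<rfloor>"

lemma shift_digits: "shift (digits x) = digits (tail_map x)"
  by (simp add: shift_def digits_def fun_eq_iff funpow_swap1)

lemma tail_map_bounds: "tail_map x \<in> {0..<1}"
  by (simp add: tail_map_def frac_lt_1)

lemma step_digit_tail_map:
  assumes "x \<in> {0..<1}"
  shows "step (digits x 0) (tail_map x) = x"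
proof -
  have "real (digits x 0) + tail_map x = x / (1 - x)"
    using assms by (simp add: digits_def tail_map_def frac_def)
  then have "step (digits x 0) (tail_map x) = (x / (1 - x)) / (x / (1 - x) + 1)"
    by (simp add: step_def)
  also have "x / (1 - x) + 1 = 1 / (1 - x)"
    using assms by (simp add: field_simps)
  finally show ?thesis
    using assms by simp
qed

lemma tail_map_funpow_bounds: "x \<in> {0..<1} \<Longrightarrow> (tail_map ^^ n) x \<in> {0..<1}"
  by (cases n) (simp, simp only: funpow.simps comp_apply tail_map_bounds)

lemma steps_digits:
  "x \<in> {0..<1} \<Longrightarrow> steps (digits x) n ((tail_map ^^ n) x) = x"
proof (induction n arbitrary: x)
  case (Suc n)
  then show ?case
    using Suc.IH[OF tail_map_bounds[of x]] step_digit_tail_map[OF Suc.prems]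
    by (simp add: shift_digits funpow_swap1)
qed simp

text \<open>For every \<open>n\<close>, both sides are images of points of the unit interval under
  \<open>steps (digits x) n\<close>, so they differ by at most \<open>1 / (n + 1)\<close>.\<close>

lemma cfrac_val_digits:
  assumes "x \<in> {0..<1}"
  shows "cfrac_val (digits x) = x"
proof -
  have "\<bar>cfrac_val (digits x) - x\<bar> \<le> 1 / real (Suc n)" for n
  proof -
    have "(tail_map ^^ n) x \<in> {0..1}" "cfrac_val ((shift ^^ n) (digits x)) \<in> {0..1}"
      using tail_map_funpow_bounds[OF assms, of n] cfrac_val_bounds[of "(shift ^^ n) (digits x)"]
      by auto
    from steps_dist_le[OF this(2,1), of "digits x" n] show ?thesis
      using steps_digits[OF assms, of n] cfrac_val_eq_steps[of "digits x" n]
      by (simp add: add.commute)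
  qed
  then have "\<not> 0 < \<bar>cfrac_val (digits x) - x\<bar>"
    by (meson nat_approx_posE not_le)
  then show ?thesis by simp
qed

lemma range_cfrac_val: "range cfrac_val = {0..<1}"
proof
  show "range cfrac_val \<subseteq> {0..<1}"
    by (rule image_subsetI) (rule cfrac_val_bounds)
  show "{0..<1} \<subseteq> range cfrac_val"
    by (rule subsetI) (rule range_eqI, erule cfrac_val_digits[symmetric])
qed

section \<open>Rational values and finite support\<close>

lemma cfrac_val_zero: "cfrac_val (\<lambda>_. 0) = 0"
proof -
  let ?v = "cfrac_val (\<lambda>_. 0)"
  have "?v = ?v / (?v + 1)"
    using cfrac_val_rec[of "\<lambda>_. 0"] by (simp add: step_def shift_def)
  then have "?v * (?v + 1) = ?v"
    using cfrac_val_nonneg[of "\<lambda>_. 0"] by (simp add: divide_simps split: if_splits)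
  then show ?thesis by (simp add: algebra_simps)
qed

lemma cfrac_val_rational:
  assumes "finite {i. k i \<noteq> 0}"
  shows "cfrac_val k \<in> \<rat>"
proof -
  obtain n where "\<forall>i\<ge>n. k i = 0"
    using assms unfolding finite_nat_set_iff_bounded by (metis mem_Collect_eq not_le)
  then show ?thesis
  proof (induction n arbitrary: k)
    case 0
    then have "k = (\<lambda>_. 0)" by auto
    then show ?case by (simp add: cfrac_val_zero)
  next
    case (Suc n)
    then have "cfrac_val (shift k) \<in> \<rat>" by (simp add: shift_def)
    then show ?case
      by (subst cfrac_val_rec) (auto simp: step_def)
  qed
qed

lemma finite_support_of_shift:
  assumes "finite {i. shift k i \<noteq> (0::nat)}"
  shows "finite {i. k i \<noteq> 0}"
proof -
  have "{i. k i \<noteq> 0} \<subseteq> insert 0 (Suc ` {i. shift k i \<noteq> 0})"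
    unfolding shift_def using not0_implies_Suc by fastforce
  then show ?thesis using assms finite_subset by blast
qed

text \<open>Strong induction on the denominator. The fraction need not be reduced, so the new
  numerator can be any integer.\<close>

lemma finite_support_if_fraction:
  fixes p :: int and q :: nat
  assumes "0 < q" "cfrac_val k = of_int p / real q"
  shows "finite {i. k i \<noteq> 0}"
  using assms
proof (induction q arbitrary: p k rule: less_induct)
  case (less q)
  show ?case
  proof (cases "p = 0")
    case True
    then have "cfrac_val k = cfrac_val (\<lambda>_. 0)"
      using less.prems by (simp add: cfrac_val_zero)
    then have "k = (\<lambda>_. 0)" by (rule injD[OF inj_cfrac_val])
    then show ?thesis by simp
  next
    case False
    have p: "0 < p" "p < int q"
      using cfrac_val_bounds[of k] less.prems False
      by (auto simp: zero_le_divide_iff divide_less_eq)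
    \<comment> \<open>The denominator of the tail value: \<open>0 < p\<close> makes it smaller than
      \<open>q\<close>, and \<open>p < q\<close> keeps it positive.\<close>
    define r where "r = nat (int q - p)"
    have r: "r < q" "0 < r" "real r = real q - of_int p"
      using p by (auto simp: r_def)
    have "1 - cfrac_val k = real r / real q"
      using less.prems r by (simp add: diff_divide_distrib)
    then have "cfrac_val k / (1 - cfrac_val k) = of_int p / real r"
      using less.prems by simp
    then have "cfrac_val (shift k) = of_int p / real r - real (k 0)"
      using cfrac_val_div[of k] by simp
    also have "\<dots> = of_int (p - int (k 0) * int r) / real r"
      using r by (simp add: field_simps)
    finally have "finite {i. shift k i \<noteq> 0}"
      using less.IH r by blast
    then show ?thesis by (rule finite_support_of_shift)
  qed
qed

lemma cfrac_val_rational_iff: "cfrac_val k \<in> \<rat> \<longleftrightarrow> finite {i. k i \<noteq> 0}"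
proof
  assume "cfrac_val k \<in> \<rat>"
  then obtain p q where "0 < q" "cfrac_val k = of_int p / of_int q"
    by (rule Rats_cases')
  then show "finite {i. k i \<noteq> 0}"
    using finite_support_if_fraction[of "nat q" k p] by simp
qed (rule cfrac_val_rational)

section \<open>Link with continued fractions in the compactified line\<close>

lemma fin_cfrac_Cons: "fin_cfrac (a # as) = add_inf (of_int a) (fin_cfrac (0 # as))"
  by (cases as) (auto simp: add_inf_def option.map_comp comp_def)

text \<open>From index 3 on, the entries for \<open>k\<close> are those for \<open>shift k\<close>
  two places earlier. At index 2 they differ: \<open>k 0\<close> stands where \<open>shift k\<close>
  has its leading 0.\<close>

lemma map_interleave_ones_Suc_Suc:
  "map (interleave_ones k) [0..<Suc (Suc (Suc n))]
    = 0 # 1 # int (k 0) # map (interleave_ones (shift k)) [1..<Suc n]"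
proof -
  have "map (interleave_ones k) [3..<n + 3] = map (interleave_ones (shift k)) [1..<Suc n]"
    by (rule nth_equalityI) (auto simp: interleave_ones_def shift_def simp del: upt_Suc elim!: oddE evenE)
  moreover have "[0..<Suc (Suc (Suc n))] = 0 # 1 # 2 # [3..<n + 3]"
    by (simp add: upt_conv_Cons numeral_eq_Suc)
  ultimately show ?thesis by (simp add: interleave_ones_def)
qed

text \<open>For \<open>t = 0\<close> the computation passes through infinity and returns to 0, so
  zero digits fit the same formula.\<close>

lemma recip_inf_one_add_recip_inf:
  assumes "0 \<le> t"
  shows "recip_inf (add_inf 1 (recip_inf (Some t))) = Some (t / (t + 1))"
proof (cases "t = 0")
  case False
  then have "1 + 1 / t = (t + 1) / t"
    by (simp add: add_divide_distrib)
  then show ?thesis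
    using assms False by (simp add: add_inf_def recip_inf_def)
qed (simp add: add_inf_def recip_inf_def)

lemma fin_cfrac_interleave_ones:
  "fin_cfrac (map (interleave_ones k) [0..<Suc n]) = Some (convergent_value k n)"
proof (induction k n rule: convergent_value.induct)
  case (3 k n)
  let ?t = "map (interleave_ones (shift k)) [1..<Suc n]"
  \<comment> \<open>The induction hypothesis concerns the list with leading 0; putting
    \<open>k 0\<close> in its place adds \<open>k 0\<close> to the value.\<close>
  have "map (interleave_ones (shift k)) [0..<Suc n] = 0 # ?t"
    by (simp add: upt_conv_Cons interleave_ones_def del: upt_Suc)
  then have "fin_cfrac (int (k 0) # ?t) = Some (real (k 0) + convergent_value (shift k) n)"
    using 3 by (subst fin_cfrac_Cons) (simp add: add_inf_def del: upt_Suc)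
  then show ?case
    using convergent_value_bounds[of "shift k" n]
    unfolding map_interleave_ones_Suc_Suc
    by (simp add: recip_inf_one_add_recip_inf step_def del: upt_Suc) (simp add: add_inf_def)
qed (auto simp: interleave_ones_def add_inf_def recip_inf_def)

text \<open>The embedding \<open>Some\<close> is continuous, so the real limit carries over; it is
  the only one because the compactification is Hausdorff.\<close>

lemma has_cfrac_value_interleave_ones:
  "has_cfrac_value (interleave_ones k) l \<longleftrightarrow> l = Some (cfrac_val k)"
proof -
  have "limitin (Alexandroff_compactification euclideanreal)
          (Some \<circ> convergent_value k) (Some (cfrac_val k)) sequentially"
    using convergent_value_tendsto
    by (intro continuous_map_limit[OF continuous_map_Some]) auto
  then have "has_cfrac_value (interleave_ones k) (Some (cfrac_val k))"
    unfolding has_cfrac_value_def fin_cfrac_interleave_ones comp_def .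
  moreover have "Hausdorff_space (Alexandroff_compactification euclideanreal)"
    by (simp add: Hausdorff_space_Alexandroff_compactification locally_compact_space_euclidean
        Hausdorff_space_euclidean)
  ultimately show ?thesis
    unfolding has_cfrac_value_def
    using limitin_Hausdorff_unique trivial_limit_sequentially by metis
qed

lemma inf_cfrac_interleave_ones: "inf_cfrac (interleave_ones k) = Some (cfrac_val k)"
  by (simp add: inf_cfrac_def has_cfrac_value_interleave_ones)

theorem theorem5p6:
  shows "(\<forall>k :: nat \<Rightarrow> nat. \<exists>!l. has_cfrac_value (interleave_ones k) l)
    \<and> bij_betw (\<lambda>k. inf_cfrac (interleave_ones k)) UNIV (Some ` {0..<1})
    \<and> (\<lambda>k. inf_cfrac (interleave_ones k)) ` {k. finite {i. k i \<noteq> 0}}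
        = Some ` ({0..<1} \<inter> \<rat>)
    \<and> (\<lambda>k. inf_cfrac (interleave_ones k)) ` {k. infinite {i. k i \<noteq> 0}}
        = Some ` ({0..<1} - \<rat>)"
proof (intro conjI)
  show "\<forall>k :: nat \<Rightarrow> nat. \<exists>!l. has_cfrac_value (interleave_ones k) l"
    by (simp add: has_cfrac_value_interleave_ones)
  show "bij_betw (\<lambda>k. inf_cfrac (interleave_ones k)) UNIV (Some ` {0..<1})"
    unfolding bij_betw_def inf_cfrac_interleave_ones range_cfrac_val[symmetric]
    using inj_cfrac_val by (auto simp: inj_def)
  show "(\<lambda>k. inf_cfrac (interleave_ones k)) ` {k. finite {i. k i \<noteq> 0}} = Some ` ({0..<1} \<inter> \<rat>)"
    \<comment> \<open>With the interval written as a range and finite support as rationality of the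
      value, only set algebra remains.\<close>
    unfolding inf_cfrac_interleave_ones range_cfrac_val[symmetric] cfrac_val_rational_iff[symmetric]
    by blast
  show "(\<lambda>k. inf_cfrac (interleave_ones k)) ` {k. infinite {i. k i \<noteq> 0}} = Some ` ({0..<1} - \<rat>)"
    unfolding inf_cfrac_interleave_ones range_cfrac_val[symmetric] cfrac_val_rational_iff[symmetric]
    by blast
qed

end
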